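(* Let $R$ be a commutative ring with $1\neq 0$, let $S$ be a multiplicatively closed subset of $R$, and assume that $\mathrm{Spec}_SR=C_1\cup C_2$ with $C_1\cap C_2=\emptyset$. The following statements are equivalent. (1) $C_1$ and $C_2$ are closed with respect to the $S$-Zariski topology. (2) There exist $f_1,f_2\in R$ with $C_i=V_S(f_i)$ for $i=1,2$, such that $f_1+f_2\in S$ and $f_1f_2\in\sqrt[S]{(0)}$. (3) $C_1$ and $C_2$ are closed with respect to the $S$-flat topology.
   Context: A multiplicatively closed subset $S$ of $R$ satisfies $0\notin S$, $1\in S$, and $ss'\in S$ for all $s,s'\in S$. An ideal $P$ of $R$ is $S$-prime if $P\cap S=\emptyset$ and there exists $s\in S$ such that for all $a,b\in R$, $ab\in P$ implies $sa\in P$ or $sb\in P$. $\mathrm{Spec}_SR$ is the set of all $S$-prime ideals of $R$. For $E\subseteq R$, $V_S(E)=\{P\in\mathrm{Spec}_SR : sE\subseteq P \text{ for some } s\in S\}$; write $V_S(f)=V_S(\{f\})$. The $S$-Zariski topology on $\mathrm{Spec}_SR$ is the topology whose closed sets are the sets $V_S(I)$, $I$ an ideal of $R$. The $S$-flat topology on $\mathrm{Spec}_SR$ is the topology having the sets $V_S(f)$, $f\in R$, as a sub-basis of open sets. The $S$-radical of an ideal $I$ is $\sqrt[S]{I}=\{a\in R : sa^n\in I\text{ for some } s\in S \text{ and } n\in\mathbb{N}\}$ ($\mathbb{N}$ the positive integers). *)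

theory Defs
  imports "HOL-Algebra.Ideal" "HOL-Analysis.Abstract_Topology"
begin

definition mult_closed_subset :: "('a, 'b) ring_scheme \<Rightarrow> 'a set \<Rightarrow> bool" where
  "mult_closed_subset R S \<longleftrightarrow>
     S \<subseteq> carrier R \<and> \<zero>\<^bsub>R\<^esub> \<notin> S \<and> \<one>\<^bsub>R\<^esub> \<in> S \<and> (\<forall>s\<in>S. \<forall>t\<in>S. s \<otimes>\<^bsub>R\<^esub> t \<in> S)"

definition S_prime :: "('a, 'b) ring_scheme \<Rightarrow> 'a set \<Rightarrow> 'a set \<Rightarrow> bool" where
  "S_prime R S P \<longleftrightarrow> ideal P R \<and> P \<inter> S = {} \<and>
     (\<exists>s\<in>S. \<forall>a\<in>carrier R. \<forall>b\<in>carrier R.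
        a \<otimes>\<^bsub>R\<^esub> b \<in> P \<longrightarrow> s \<otimes>\<^bsub>R\<^esub> a \<in> P \<or> s \<otimes>\<^bsub>R\<^esub> b \<in> P)"

definition S_Spec :: "('a, 'b) ring_scheme \<Rightarrow> 'a set \<Rightarrow> 'a set set" where
  "S_Spec R S = {P. S_prime R S P}"

definition S_V :: "('a, 'b) ring_scheme \<Rightarrow> 'a set \<Rightarrow> 'a set \<Rightarrow> 'a set set" where
  "S_V R S E = {P \<in> S_Spec R S. \<exists>s\<in>S. (\<lambda>e. s \<otimes>\<^bsub>R\<^esub> e) ` E \<subseteq> P}"

definition S_radical :: "('a, 'b) ring_scheme \<Rightarrow> 'a set \<Rightarrow> 'a set \<Rightarrow> 'a set" where
  "S_radical R S I =
     {a \<in> carrier R. \<exists>s\<in>S. \<exists>n::nat. 0 < n \<and> s \<otimes>\<^bsub>R\<^esub> (a [^]\<^bsub>R\<^esub> n) \<in> I}"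

text \<open>That the sets below do form a topology (so that the abstraction function
  \<open>topology\<close> is applied inside its domain) is \<open>istopology_S_Zariski\<close>.\<close>

definition S_Zariski :: "('a, 'b) ring_scheme \<Rightarrow> 'a set \<Rightarrow> 'a set topology" where
  "S_Zariski R S =
     topology (\<lambda>U. U \<subseteq> S_Spec R S \<and> (\<exists>I. ideal I R \<and> S_Spec R S - U = S_V R S I))"

definition S_flat :: "('a, 'b) ring_scheme \<Rightarrow> 'a set \<Rightarrow> 'a set topology" where
  "S_flat R S = topology_generated_by {S_V R S {f} | f. f \<in> carrier R}"

lemma S_V_subset: "S_V R S E \<subseteq> S_Spec R S"
  by (auto simp: S_V_def)

context cring
begin

text \<open>The element witnessing that \<open>P\<close> is \<open>S\<close>-prime works uniformly for all \<open>E\<close>, and the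
  \<open>x\<close> it multiplies into \<open>P\<close> form an ideal.\<close>

lemma S_prime_uniform:
  assumes S: "mult_closed_subset R S" and P: "P \<in> S_Spec R S"
  obtains s where "s \<in> S" "ideal {x \<in> carrier R. s \<otimes> x \<in> P} R"
    "\<And>a b. \<lbrakk>a \<in> carrier R; b \<in> carrier R; a \<otimes> b \<in> P\<rbrakk> \<Longrightarrow> s \<otimes> a \<in> P \<or> s \<otimes> b \<in> P"
    "\<And>E. E \<subseteq> carrier R \<Longrightarrow> P \<in> S_V R S E \<longleftrightarrow> E \<subseteq> {x \<in> carrier R. s \<otimes> x \<in> P}"
proof -
  from P obtain s where s: "s \<in> S" and I: "ideal P R" and disj: "P \<inter> S = {}"
    and pr: "\<And>a b. \<lbrakk>a \<in> carrier R; b \<in> carrier R; a \<otimes> b \<in> P\<rbrakk> \<Longrightarrow> s \<otimes> a \<in> P \<or> s \<otimes> b \<in> P"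
    unfolding S_Spec_def S_prime_def by blast
  have SR: "S \<subseteq> carrier R" and mS: "\<And>s t. s \<in> S \<Longrightarrow> t \<in> S \<Longrightarrow> s \<otimes> t \<in> S"
    using S by (auto simp: mult_closed_subset_def)
  interpret P: ideal P R by fact
  have sR: "s \<in> carrier R" using s SR by auto
  have id: "ideal {x \<in> carrier R. s \<otimes> x \<in> P} R"
  proof (rule idealI[OF ring_axioms])
    show "subgroup {x \<in> carrier R. s \<otimes> x \<in> P} (add_monoid R)"
    proof (rule add.subgroupI)
      show "{x \<in> carrier R. s \<otimes> x \<in> P} \<noteq> {}"
        using sR P.zero_closed by (auto intro!: exI[of _ \<zero>])
      show "\<ominus> a \<in> {x \<in> carrier R. s \<otimes> x \<in> P}" if "a \<in> {x \<in> carrier R. s \<otimes> x \<in> P}" for a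
        using that sR P.a_inv_closed by (auto simp: r_minus)
      show "a \<oplus> b \<in> {x \<in> carrier R. s \<otimes> x \<in> P}"
        if "a \<in> {x \<in> carrier R. s \<otimes> x \<in> P}" "b \<in> {x \<in> carrier R. s \<otimes> x \<in> P}" for a b
        using that sR P.a_closed by (auto simp: r_distr)
    qed auto
    show "x \<otimes> a \<in> {x \<in> carrier R. s \<otimes> x \<in> P}"
      if "a \<in> {x \<in> carrier R. s \<otimes> x \<in> P}" "x \<in> carrier R" for a x
      using that sR P.I_l_closed[of "s \<otimes> a" x] m_lcomm[of s x a] by auto
    show "a \<otimes> x \<in> {x \<in> carrier R. s \<otimes> x \<in> P}"
      if "a \<in> {x \<in> carrier R. s \<otimes> x \<in> P}" "x \<in> carrier R" for a x
      using that sR P.I_r_closed[of "s \<otimes> a" x] m_assoc[of s a x] by auto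
  qed
  have uni: "P \<in> S_V R S E \<longleftrightarrow> E \<subseteq> {x \<in> carrier R. s \<otimes> x \<in> P}" if E: "E \<subseteq> carrier R" for E
  proof
    assume "P \<in> S_V R S E"
    then obtain t where t: "t \<in> S" "\<And>e. e \<in> E \<Longrightarrow> t \<otimes> e \<in> P"
      by (auto simp: S_V_def)
    show "E \<subseteq> {x \<in> carrier R. s \<otimes> x \<in> P}"
    proof
      fix e assume e: "e \<in> E"
      have "s \<otimes> t \<notin> P" using mS[OF s t(1)] disj by auto
      then show "e \<in> {x \<in> carrier R. s \<otimes> x \<in> P}"
        using pr[of t e] t e SR E by auto
    qed
  next
    assume "E \<subseteq> {x \<in> carrier R. s \<otimes> x \<in> P}"
    then show "P \<in> S_V R S E" using P s by (auto simp: S_V_def)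
  qed
  show thesis using that[OF s id pr uni] by blast
qed

lemma S_V_Un:
  assumes S: "mult_closed_subset R S" and I: "ideal I R" and J: "ideal J R"
  shows "S_V R S I \<union> S_V R S J = S_V R S (I \<inter> J)"
proof
  show "S_V R S I \<union> S_V R S J \<subseteq> S_V R S (I \<inter> J)"
    unfolding S_V_def by fast
next
  interpret I: ideal I R by fact
  interpret J: ideal J R by fact
  show "S_V R S (I \<inter> J) \<subseteq> S_V R S I \<union> S_V R S J"
  proof
    fix P assume PV: "P \<in> S_V R S (I \<inter> J)"
    then have P: "P \<in> S_Spec R S" by (simp add: S_V_def)
    obtain s where s: "s \<in> S"
      and id: "ideal {x \<in> carrier R. s \<otimes> x \<in> P} R"
      and pr: "\<And>a b. \<lbrakk>a \<in> carrier R; b \<in> carrier R; a \<otimes> b \<in> P\<rbrakk> \<Longrightarrow> s \<otimes> a \<in> P \<or> s \<otimes> b \<in> P"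
      and uni: "\<And>E. E \<subseteq> carrier R \<Longrightarrow> P \<in> S_V R S E \<longleftrightarrow> E \<subseteq> {x \<in> carrier R. s \<otimes> x \<in> P}"
      by (rule S_prime_uniform[OF S P]) (rule that; blast)
    have sR: "s \<in> carrier R" using s S by (auto simp: mult_closed_subset_def)
    show "P \<in> S_V R S I \<union> S_V R S J"
    proof (rule ccontr)
      assume "P \<notin> S_V R S I \<union> S_V R S J"
      then have nI: "P \<notin> S_V R S I" and nJ: "P \<notin> S_V R S J" by auto
      have "\<exists>b\<in>J. s \<otimes> b \<notin> P"
        using nJ uni[of J] J.Icarr by blast
      then obtain b where b: "b \<in> J" "s \<otimes> b \<notin> P" by blast
      have "s \<otimes> a \<in> {x \<in> carrier R. s \<otimes> x \<in> P}" if a: "a \<in> I" for a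
      proof -
        have aR: "a \<in> carrier R" "b \<in> carrier R" using a b by auto
        have "a \<otimes> b \<in> I \<inter> J"
          using a b aR I.I_r_closed J.I_l_closed by auto
        then have "s \<otimes> (a \<otimes> b) \<in> P" using uni[of "I \<inter> J"] PV I.Icarr by blast
        then have "(s \<otimes> a) \<otimes> b \<in> P" using aR sR by (simp add: m_assoc)
        then show ?thesis using pr[of "s \<otimes> a" b] aR sR b by auto
      qed
      then have "\<And>a. a \<in> I \<Longrightarrow> s \<otimes> (s \<otimes> a) \<in> P" by blast
      then have "\<And>a. a \<in> I \<Longrightarrow> (s \<otimes> s) \<otimes> a \<in> P"
        using sR by (simp add: m_assoc)
      moreover have "s \<otimes> s \<in> S" using S s by (auto simp: mult_closed_subset_def)
      ultimately have "P \<in> S_V R S I" using P by (auto simp: S_V_def)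
      with nI show False by simp
    qed
  qed
qed

lemma S_V_genideal_Union:
  assumes S: "mult_closed_subset R S" and F: "\<And>I. I \<in> F \<Longrightarrow> I \<subseteq> carrier R"
  shows "S_V R S (Idl (\<Union>F)) = S_Spec R S \<inter> (\<Inter>I\<in>F. S_V R S I)"
proof -
  have "P \<in> S_V R S (Idl (\<Union>F)) \<longleftrightarrow> (\<forall>I\<in>F. P \<in> S_V R S I)" if P: "P \<in> S_Spec R S" for P
  proof -
    obtain s where "s \<in> S"
      and id: "ideal {x \<in> carrier R. s \<otimes> x \<in> P} R"
      and "\<And>a b. \<lbrakk>a \<in> carrier R; b \<in> carrier R; a \<otimes> b \<in> P\<rbrakk> \<Longrightarrow> s \<otimes> a \<in> P \<or> s \<otimes> b \<in> P"
      and uni: "\<And>E. E \<subseteq> carrier R \<Longrightarrow> P \<in> S_V R S E \<longleftrightarrow> E \<subseteq> {x \<in> carrier R. s \<otimes> x \<in> P}"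
      by (rule S_prime_uniform[OF S P]) (rule that; blast)
    have FR: "\<Union>F \<subseteq> carrier R" using F by blast
    have "Idl (\<Union>F) \<subseteq> carrier R"
      using ideal.Icarr[OF genideal_ideal[OF FR]] by (rule subsetI)
    then have "P \<in> S_V R S (Idl (\<Union>F)) \<longleftrightarrow> \<Union>F \<subseteq> {x \<in> carrier R. s \<otimes> x \<in> P}"
      using uni genideal_self[OF FR] genideal_minimal[OF id] by (meson order_trans)
    also have "\<dots> \<longleftrightarrow> (\<forall>I\<in>F. P \<in> S_V R S I)"
      using F uni by blast
    finally show ?thesis .
  qed
  then show ?thesis using S_V_subset[of R S "Idl (\<Union>F)"] by blast
qed

lemma istopology_S_Zariski:
  assumes S: "mult_closed_subset R S"
  shows "istopology (\<lambda>U. U \<subseteq> S_Spec R S \<and> (\<exists>I. ideal I R \<and> S_Spec R S - U = S_V R S I))"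
    (is "istopology ?L")
  unfolding istopology_def
proof (intro conjI allI impI)
  fix U W assume U: "?L U" and W: "?L W"
  then show "U \<inter> W \<subseteq> S_Spec R S" by blast
  from U W obtain I J where I: "ideal I R" "S_Spec R S - U = S_V R S I"
    and J: "ideal J R" "S_Spec R S - W = S_V R S J" by blast
  have "S_Spec R S - U \<inter> W = S_V R S (I \<inter> J)"
    using S_V_Un[OF S I(1) J(1)] I J by blast
  then show "\<exists>I. ideal I R \<and> S_Spec R S - U \<inter> W = S_V R S I"
    using i_intersect[OF I(1) J(1)] by blast
next
  fix K assume K: "\<forall>U\<in>K. ?L U"
  then show "\<Union>K \<subseteq> S_Spec R S" by blast
  have "\<forall>U\<in>K. \<exists>I. ideal I R \<and> S_Spec R S - U = S_V R S I" using K by simp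
  from bchoice[OF this] obtain I
    where I: "\<forall>U\<in>K. ideal (I U) R \<and> S_Spec R S - U = S_V R S (I U)" by (rule exE)
  have FR: "\<And>J. J \<in> I ` K \<Longrightarrow> J \<subseteq> carrier R" by (use I ideal.Icarr in fast)
  have IV: "\<And>U. U \<in> K \<Longrightarrow> S_V R S (I U) = S_Spec R S - U" using I by metis
  have "S_Spec R S - \<Union>K = S_V R S (Idl (\<Union>(I ` K)))"
    by (subst S_V_genideal_Union[OF S], erule FR) (auto simp: IV)
  moreover have "ideal (Idl (\<Union>(I ` K))) R"
    using FR by (intro genideal_ideal) blast
  ultimately show "\<exists>I. ideal I R \<and> S_Spec R S - \<Union>K = S_V R S I" by blast
qed

lemma S_V_zero:
  assumes S: "mult_closed_subset R S"
  shows "S_V R S {\<zero>} = S_Spec R S"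
proof -
  have 1: "\<one> \<in> S" using S by (simp add: mult_closed_subset_def)
  have "\<zero> \<in> P" if "P \<in> S_Spec R S" for P
    using that by (simp add: S_Spec_def S_prime_def additive_subgroup.zero_closed ideal.axioms(1))
  then show ?thesis
    unfolding S_V_def using 1 by (auto intro!: bexI[of _ \<one>])
qed

lemma openin_S_Zariski:
  assumes "mult_closed_subset R S"
  shows "openin (S_Zariski R S) U \<longleftrightarrow>
    U \<subseteq> S_Spec R S \<and> (\<exists>I. ideal I R \<and> S_Spec R S - U = S_V R S I)"
  unfolding S_Zariski_def by (simp add: topology_inverse'[OF istopology_S_Zariski[OF assms]])

lemma topspace_S_Zariski:
  assumes S: "mult_closed_subset R S"
  shows "topspace (S_Zariski R S) = S_Spec R S"
proof -
  have SR: "S \<subseteq> carrier R" using S by (simp add: mult_closed_subset_def)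
  have "P \<notin> S_V R S (carrier R)" for P
  proof
    assume "P \<in> S_V R S (carrier R)"
    then obtain s where "P \<inter> S = {}" "s \<in> S" "s \<otimes> \<one> \<in> P"
      unfolding S_V_def S_Spec_def S_prime_def by fast
    moreover from this SR have "s \<otimes> \<one> = s" by (intro r_one) (rule subsetD)
    ultimately show False by auto
  qed
  then have "S_V R S (carrier R) = {}" by blast
  then have "openin (S_Zariski R S) (S_Spec R S)"
    unfolding openin_S_Zariski[OF S] using oneideal by blast
  then show ?thesis
    using openin_S_Zariski[OF S] openin_topspace openin_subset by (metis subset_antisym)
qed

lemma closedin_S_Zariski:
  assumes S: "mult_closed_subset R S"
  shows "closedin (S_Zariski R S) C \<longleftrightarrow> (\<exists>I. ideal I R \<and> C = S_V R S I)"
  unfolding closedin_def openin_S_Zariski[OF S] topspace_S_Zariski[OF S]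
  using S_V_subset[of R S] by (metis Diff_subset double_diff subset_refl)

lemma topspace_S_flat:
  assumes S: "mult_closed_subset R S"
  shows "topspace (S_flat R S) = S_Spec R S"
  unfolding S_flat_def topology_generated_by_topspace
  using S_V_zero[OF S] S_V_subset[of R S] by blast

end

end

theory Submission
  imports Defs "HOL-Algebra.Ring_Divisibility" "HOL-Analysis.Function_Topology"
begin

text \<open>
  Everything reduces to ordinary prime ideals. If \<open>s\<close> witnesses that \<open>P\<close> is \<open>S\<close>-prime,
  then \<open>(P : s) = {x. s x \<in> P}\<close> is a prime ideal that does not meet \<open>S\<close>, and \<open>P\<close> lies in
  \<open>V\<^sub>S(E)\<close> exactly when \<open>E \<subseteq> (P : s)\<close>; conversely every prime ideal that does not meet \<open>S\<close> is
  \<open>S\<close>-prime (\<open>S_prime_saturation\<close>, \<open>primeideal_in_S_V_iff\<close>). So the sets \<open>V\<^sub>S(E)\<close> obey the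
  same rules as the closed sets of a prime spectrum, and existence statements about them follow
  from Krull's separation of an ideal from a multiplicative set by a prime ideal
  (\<open>primeideal_avoiding\<close>).

  \<^emph>\<open>From Zariski closed parts to generators.\<close> If \<open>C\<^sub>1 = V\<^sub>S(I)\<close> and \<open>C\<^sub>2 = V\<^sub>S(J)\<close> are disjoint, then \<open>V\<^sub>S(I + J)\<close> is
  empty, so \<open>I + J\<close> meets \<open>S\<close>; this yields \<open>f\<^sub>1 \<in> I\<close> and \<open>f\<^sub>2 \<in> J\<close> with sum in \<open>S\<close>. The sets
  \<open>V\<^sub>S(f\<^sub>i)\<close> contain the \<open>C\<^sub>i\<close> and are still disjoint, hence equal to them. As they cover the
  spectrum, \<open>f\<^sub>1 f\<^sub>2\<close> lies in every prime ideal that does not meet \<open>S\<close>, that is, in the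
  \<open>S\<close>-radical of zero (\<open>S_radical_iff_S_V\<close>).

  \<^emph>\<open>From generators to flat closed parts.\<close> Each \<open>C\<^sub>i = V\<^sub>S(f\<^sub>i)\<close> is flat open, and it is the complement of the other.

  \<^emph>\<open>From flat closed to Zariski closed parts.\<close> The flat topology is compact (\<open>compact_space_S_flat\<close>), so a flat closed set
  \<open>C\<^sub>i\<close> is compact. It is also flat open, hence a union of basic flat open sets. These are finite
  intersections of sets \<open>V\<^sub>S(f)\<close>, so they are Zariski closed, and by compactness finitely many of
  them already give \<open>C\<^sub>i\<close>.
\<close>

section \<open>Prime ideals avoiding a multiplicative set\<close>

context cring
begin

text \<open>Zorn's lemma, as a union of a chain of ideals avoiding \<open>T\<close> is again one.\<close>

lemma ideal_maximal_avoiding: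
  assumes I: "ideal I R" and disj: "I \<inter> T = {}"
  obtains M where "ideal M R" "I \<subseteq> M" "M \<inter> T = {}"
    "\<And>J. \<lbrakk>ideal J R; M \<subseteq> J; J \<inter> T = {}\<rbrakk> \<Longrightarrow> J = M"
proof -
  let ?A = "{J. ideal J R \<and> I \<subseteq> J \<and> J \<inter> T = {}}"
  have "\<exists>M\<in>?A. \<forall>J\<in>?A. M \<subseteq> J \<longrightarrow> J = M"
  proof (rule subset_Zorn_nonempty)
    show "?A \<noteq> {}" using I disj by blast
    fix C assume ne: "C \<noteq> {}" and ch: "subset.chain ?A C"
    then have sub: "C \<subseteq> ?A" by (auto simp: pred_on.chain_def)
    have "subset.chain {J. ideal J R} C"
      using ch by (auto simp: pred_on.chain_def)
    from chain_Union_is_ideal[OF this] ne have "ideal (\<Union>C) R" by simp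
    then show "\<Union>C \<in> ?A" using sub ne by blast
  qed
  then obtain M where M: "M \<in> ?A" and max: "\<forall>J\<in>?A. M \<subseteq> J \<longrightarrow> J = M" by (rule bexE)
  show thesis
  proof (rule that[of M])
    fix J assume J: "ideal J R" "M \<subseteq> J" "J \<inter> T = {}"
    then have "J \<in> ?A" using M by auto
    then show "J = M" using max J(2) by simp
  qed (use M in auto)
qed

text \<open>Krull's separation lemma. An ideal \<open>M\<close> maximal among those containing \<open>I\<close> and avoiding \<open>T\<close>
  is prime: for \<open>a, b \<notin> M\<close> both \<open>M + (a)\<close> and \<open>M + (b)\<close> meet \<open>T\<close>, and if \<open>a b\<close> were in \<open>M\<close>,
  the product of the two elements found would lie in \<open>M \<inter> T\<close>.\<close>

lemma primeideal_avoiding: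
  assumes T: "mult_closed_subset R T" and I: "ideal I R" and disj: "I \<inter> T = {}"
  obtains Q where "primeideal Q R" "I \<subseteq> Q" "Q \<inter> T = {}"
proof -
  obtain M where M: "ideal M R" "I \<subseteq> M" "M \<inter> T = {}"
    and max: "\<And>J. \<lbrakk>ideal J R; M \<subseteq> J; J \<inter> T = {}\<rbrakk> \<Longrightarrow> J = M"
    using ideal_maximal_avoiding[OF I disj] by blast
  interpret M: ideal M R by fact
  have TR: "T \<subseteq> carrier R" and one: "\<one> \<in> T" and mT: "\<And>s t. \<lbrakk>s \<in> T; t \<in> T\<rbrakk> \<Longrightarrow> s \<otimes> t \<in> T"
    using T by (auto simp: mult_closed_subset_def)
  have meet: "\<exists>m\<in>M. \<exists>r\<in>carrier R. m \<oplus> r \<otimes> a \<in> T" if a: "a \<in> carrier R" "a \<notin> M" for a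
  proof (rule ccontr)
    assume none: "\<not> ?thesis"
    let ?J = "M <+>\<^bsub>R\<^esub> PIdl a"
    have J: "?J = {m \<oplus> r \<otimes> a | m r. m \<in> M \<and> r \<in> carrier R}"
      by (auto simp: set_add_def' cgenideal_def)
    have "ideal ?J R" by (rule add_ideals[OF M(1) cgenideal_ideal[OF a(1)]])
    moreover have "M \<subseteq> ?J"
    proof
      fix m assume m: "m \<in> M"
      then have "m = m \<oplus> \<zero> \<otimes> a" using a by simp
      with m show "m \<in> ?J" unfolding J by blast
    qed
    moreover have "?J \<inter> T = {}" using none by (auto simp: J)
    ultimately have "?J = M" by (rule max)
    moreover have "a \<in> ?J"
    proof -
      have "a = \<zero> \<oplus> \<one> \<otimes> a" using a by simp
      then show ?thesis unfolding J using M.zero_closed by blast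
    qed
    ultimately show False using a by simp
  qed
  have "primeideal M R"
  proof (rule primeidealI[OF M(1) is_cring])
    show "carrier R \<noteq> M" using one TR M(3) by blast
  next
    fix a b assume a: "a \<in> carrier R" and b: "b \<in> carrier R" and ab: "a \<otimes> b \<in> M"
    show "a \<in> M \<or> b \<in> M"
    proof (rule ccontr)
      assume "\<not> ?thesis"
      with meet a b obtain m r n q where *: "m \<in> M" "r \<in> carrier R" "m \<oplus> r \<otimes> a \<in> T"
        "n \<in> M" "q \<in> carrier R" "n \<oplus> q \<otimes> b \<in> T" by metis
      have c: "m \<in> carrier R" "n \<in> carrier R" using * by auto
      have eq: "(m \<oplus> r \<otimes> a) \<otimes> (n \<oplus> q \<otimes> b) =
          (n \<oplus> q \<otimes> b) \<otimes> m \<oplus> ((r \<otimes> a) \<otimes> n \<oplus> (r \<otimes> q) \<otimes> (a \<otimes> b))"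
        using *(2,5) a b c by algebra
      have "(n \<oplus> q \<otimes> b) \<otimes> m \<in> M" "(r \<otimes> a) \<otimes> n \<in> M" "(r \<otimes> q) \<otimes> (a \<otimes> b) \<in> M"
        by (intro M.I_l_closed * ab a_closed m_closed a b c)+
      then have "(m \<oplus> r \<otimes> a) \<otimes> (n \<oplus> q \<otimes> b) \<in> M"
        unfolding eq by (intro M.a_closed)
      then show False using mT[OF *(3,6)] M(3) by (metis disjoint_iff)
    qed
  qed
  then show thesis using M that by blast
qed

section \<open>\<open>S\<close>-primes through their saturations\<close>

text \<open>The prime ideal is \<open>(P : s)\<close>, for a witness \<open>s\<close> of \<open>S\<close>-primality. It is prime because
  multiplying by further powers of \<open>s\<close> never brings an element into \<open>P\<close> that \<open>s\<close> itself
  does not.\<close>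

lemma S_prime_saturation:
  assumes S: "mult_closed_subset R S" and P: "P \<in> S_Spec R S"
  obtains Q where "primeideal Q R" "Q \<inter> S = {}"
    "\<And>E. E \<subseteq> carrier R \<Longrightarrow> P \<in> S_V R S E \<longleftrightarrow> E \<subseteq> Q"
proof -
  obtain s where s: "s \<in> S" and id: "ideal {x \<in> carrier R. s \<otimes> x \<in> P} R" (is "ideal ?Q R")
    and pr: "\<And>a b. \<lbrakk>a \<in> carrier R; b \<in> carrier R; a \<otimes> b \<in> P\<rbrakk> \<Longrightarrow> s \<otimes> a \<in> P \<or> s \<otimes> b \<in> P"
    and uni: "\<And>E. E \<subseteq> carrier R \<Longrightarrow> P \<in> S_V R S E \<longleftrightarrow> E \<subseteq> {x \<in> carrier R. s \<otimes> x \<in> P}"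
    by (rule S_prime_uniform[OF S P]) (rule that; blast)
  have SR: "S \<subseteq> carrier R" and one: "\<one> \<in> S" and mS: "\<And>s t. \<lbrakk>s \<in> S; t \<in> S\<rbrakk> \<Longrightarrow> s \<otimes> t \<in> S"
    using S by (auto simp: mult_closed_subset_def)
  have disj: "P \<inter> S = {}" using P by (simp add: S_Spec_def S_prime_def)
  have QS: "?Q \<inter> S = {}" using mS[OF s] disj by blast
  have "primeideal ?Q R"
  proof (rule primeidealI[OF id is_cring])
    show "carrier R \<noteq> ?Q" using one SR QS by blast
  next
    fix a b assume a: "a \<in> carrier R" and b: "b \<in> carrier R" and ab: "a \<otimes> b \<in> ?Q"
    have sR: "s \<in> carrier R" using s SR by blast
    have "(s \<otimes> a) \<otimes> b \<in> P" using ab a b sR by (simp add: m_assoc)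
    then consider "s \<otimes> (s \<otimes> a) \<in> P" | "s \<otimes> b \<in> P" using pr[of "s \<otimes> a" b] a b sR by auto
    then show "a \<in> ?Q \<or> b \<in> ?Q"
    proof cases
      case 1
      then have "(s \<otimes> s) \<otimes> a \<in> P" using a sR by (simp add: m_assoc)
      then have "s \<otimes> (s \<otimes> s) \<in> P \<or> s \<otimes> a \<in> P" using pr[of "s \<otimes> s" a] a sR by auto
      then show ?thesis using mS[OF s mS[OF s s]] disj a by blast
    qed (use b in auto)
  qed
  then show thesis using QS uni that by blast
qed

lemma primeideal_in_S_Spec:
  assumes S: "mult_closed_subset R S" and Q: "primeideal Q R" "Q \<inter> S = {}"
  shows "Q \<in> S_Spec R S"
proof -
  interpret Q: primeideal Q R by fact
  have "\<one> \<in> S" using S by (simp add: mult_closed_subset_def)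
  moreover have "\<one> \<otimes> a \<in> Q \<or> \<one> \<otimes> b \<in> Q"
    if "a \<in> carrier R" "b \<in> carrier R" "a \<otimes> b \<in> Q" for a b
    using that Q.I_prime by simp
  ultimately have "\<exists>s\<in>S. \<forall>a\<in>carrier R. \<forall>b\<in>carrier R. a \<otimes> b \<in> Q \<longrightarrow> s \<otimes> a \<in> Q \<or> s \<otimes> b \<in> Q"
    by blast
  then show ?thesis
    using Q(2) Q.is_ideal by (simp add: S_Spec_def S_prime_def)
qed

lemma primeideal_in_S_V_iff:
  assumes S: "mult_closed_subset R S" and Q: "primeideal Q R" "Q \<inter> S = {}"
    and E: "E \<subseteq> carrier R"
  shows "Q \<in> S_V R S E \<longleftrightarrow> E \<subseteq> Q"
proof
  interpret Q: primeideal Q R by fact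
  assume "Q \<in> S_V R S E"
  then obtain s where s: "s \<in> S" "\<And>e. e \<in> E \<Longrightarrow> s \<otimes> e \<in> Q" by (auto simp: S_V_def)
  have "s \<in> carrier R" using s S by (auto simp: mult_closed_subset_def)
  then show "E \<subseteq> Q" using s E Q(2) Q.I_prime by blast
next
  assume "E \<subseteq> Q"
  moreover have "\<one> \<in> S" using S by (simp add: mult_closed_subset_def)
  ultimately show "Q \<in> S_V R S E"
    using primeideal_in_S_Spec[OF S Q] E by (force simp: S_V_def intro!: bexI[of _ \<one>])
qed

lemma S_V_mult:
  assumes S: "mult_closed_subset R S" and a: "a \<in> carrier R" and b: "b \<in> carrier R"
  shows "S_V R S {a \<otimes> b} = S_V R S {a} \<union> S_V R S {b}"
proof -
  have "P \<in> S_V R S {a \<otimes> b} \<longleftrightarrow> P \<in> S_V R S {a} \<union> S_V R S {b}" if P: "P \<in> S_Spec R S" for P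
  proof -
    obtain Q where Q: "primeideal Q R" "Q \<inter> S = {}"
      "\<And>E. E \<subseteq> carrier R \<Longrightarrow> P \<in> S_V R S E \<longleftrightarrow> E \<subseteq> Q"
      using S_prime_saturation[OF S P] by blast
    interpret Q: primeideal Q R by fact
    show ?thesis using Q(3)[of "{_}"] a b Q.I_prime Q.I_l_closed Q.I_r_closed by auto
  qed
  then show ?thesis using S_V_subset by blast
qed

lemma S_V_eq_empty:
  assumes S: "mult_closed_subset R S" and E: "E \<subseteq> carrier R" and meet: "E \<inter> S \<noteq> {}"
  shows "S_V R S E = {}"
proof -
  have False if PE: "P \<in> S_V R S E" for P
  proof -
    have "P \<in> S_Spec R S" using PE by (simp add: S_V_def)
    from S_prime_saturation[OF S this] obtain Q where "Q \<inter> S = {}" "P \<in> S_V R S E \<longleftrightarrow> E \<subseteq> Q"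
      using E by metis
    then show False using PE meet by blast
  qed
  then show ?thesis by blast
qed

lemma ideal_meets_S:
  assumes S: "mult_closed_subset R S" and I: "ideal I R" and empty: "S_V R S I = {}"
  shows "I \<inter> S \<noteq> {}"
proof
  assume "I \<inter> S = {}"
  then obtain Q where Q: "primeideal Q R" "I \<subseteq> Q" "Q \<inter> S = {}"
    using primeideal_avoiding[OF S I] by blast
  have "I \<subseteq> carrier R" using ideal.Icarr[OF I] by blast
  then have "Q \<in> S_V R S I" using primeideal_in_S_V_iff[OF S Q(1,3)] Q(2) by blast
  then show False using empty by simp
qed

text \<open>The analogue of the description of a radical as the intersection of the primes above an ideal.
  For the harder direction, if no \<open>s f\<^sup>n\<close> lies in \<open>I\<close>, then a prime ideal above \<open>I\<close> avoids the
  multiplicative set of all these elements, and it is a point of \<open>V\<^sub>S(I)\<close> outside \<open>V\<^sub>S(f)\<close>.\<close>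

lemma S_radical_iff_S_V:
  assumes S: "mult_closed_subset R S" and I: "ideal I R" and f: "f \<in> carrier R"
  shows "f \<in> S_radical R S I \<longleftrightarrow> S_V R S I \<subseteq> S_V R S {f}"
proof
  interpret I: ideal I R by fact
  have IR: "I \<subseteq> carrier R" by auto
  have SR: "S \<subseteq> carrier R" and one: "\<one> \<in> S" and mS: "\<And>s t. \<lbrakk>s \<in> S; t \<in> S\<rbrakk> \<Longrightarrow> s \<otimes> t \<in> S"
    using S by (auto simp: mult_closed_subset_def)
  {
    assume "f \<in> S_radical R S I"
    then obtain s n where s: "s \<in> S" "s \<otimes> f [^] (n::nat) \<in> I" by (auto simp: S_radical_def)
    have pow: "f \<in> Q" if "primeideal Q R" "f [^] (n::nat) \<in> Q" for Q n
    proof -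
      interpret Q: primeideal Q R by fact
      from that(2) show ?thesis
      proof (induction n)
        case 0
        then show ?case using Q.one_imp_carrier f by auto
      next
        case (Suc n)
        then show ?case using Q.I_prime[of "f [^] n" f] f by auto
      qed
    qed
    show "S_V R S I \<subseteq> S_V R S {f}"
    proof
      fix P assume P: "P \<in> S_V R S I"
      then have "P \<in> S_Spec R S" by (simp add: S_V_def)
      from S_prime_saturation[OF S this] obtain Q where Q: "primeideal Q R" "Q \<inter> S = {}"
        "\<And>E. E \<subseteq> carrier R \<Longrightarrow> P \<in> S_V R S E \<longleftrightarrow> E \<subseteq> Q" by blast
      have "s \<otimes> f [^] n \<in> Q" using Q(3)[OF IR] P s by blast
      then have "f [^] n \<in> Q"
        using primeideal.I_prime[OF Q(1), of s "f [^] n"] s SR f Q(2) by blast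
      then have "f \<in> Q" by (rule pow[OF Q(1)])
      then show "P \<in> S_V R S {f}" using Q(3)[of "{f}"] f by simp
    qed
  next
    assume sub: "S_V R S I \<subseteq> S_V R S {f}"
    show "f \<in> S_radical R S I"
    proof (rule ccontr)
      assume nrad: "f \<notin> S_radical R S I"
      define T where "T = {s \<otimes> f [^] n | s (n::nat). s \<in> S}"
      \<comment> \<open>The radical asks for a positive exponent, so multiply by \<open>f\<close> to cover \<open>n = 0\<close>.\<close>
      have avoid: "s \<otimes> f [^] n \<notin> I" if "s \<in> S" for s and n :: nat
      proof
        assume "s \<otimes> f [^] n \<in> I"
        then have "(s \<otimes> f [^] n) \<otimes> f \<in> I" by (rule I.I_r_closed[OF _ f])
        then have "s \<otimes> f [^] Suc n \<in> I" using that SR f by (auto simp: m_assoc)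
        then show False using nrad that f unfolding S_radical_def by blast
      qed
      have ST: "s \<in> T" if "s \<in> S" for s
      proof -
        have "s = s \<otimes> f [^] (0::nat)" using that SR by auto
        then show ?thesis unfolding T_def using that by blast
      qed
      have fT: "f \<in> T"
      proof -
        have "f = \<one> \<otimes> f [^] (1::nat)" using f by simp
        then show ?thesis unfolding T_def using one by blast
      qed
      have "mult_closed_subset R T"
        unfolding mult_closed_subset_def
      proof (intro conjI ballI)
        show "T \<subseteq> carrier R" using SR f by (auto simp: T_def)
        show "\<zero> \<notin> T"
        proof
          assume "\<zero> \<in> T"
          then obtain s n where "s \<in> S" "\<zero> = s \<otimes> f [^] (n::nat)" unfolding T_def by blast
          then show False using avoid[of s n] I.zero_closed by simp
        qed
        show "\<one> \<in> T" by (rule ST[OF one])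
        fix x y assume "x \<in> T" "y \<in> T"
        then obtain s t m n where st: "s \<in> S" "t \<in> S" and xy: "x = s \<otimes> f [^] (m::nat)" "y = t \<otimes> f [^] (n::nat)"
          by (auto simp: T_def)
        have "x \<otimes> y = (s \<otimes> t) \<otimes> (f [^] m \<otimes> f [^] n)"
          using st SR f unfolding xy by (simp add: m_ac subset_iff)
        also have "\<dots> = (s \<otimes> t) \<otimes> f [^] (m + n)" using f by (simp add: nat_pow_mult)
        finally show "x \<otimes> y \<in> T" unfolding T_def using mS[OF st] by blast
      qed
      moreover have "I \<inter> T = {}" using avoid by (auto simp: T_def)
      ultimately obtain Q where Q: "primeideal Q R" "I \<subseteq> Q" "Q \<inter> T = {}"
        using primeideal_avoiding[OF _ I] by blast
      have QS: "Q \<inter> S = {}" using ST Q(3) by blast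
      have "Q \<in> S_V R S I" using primeideal_in_S_V_iff[OF S Q(1) QS IR] Q(2) by simp
      then have "f \<in> Q" using primeideal_in_S_V_iff[OF S Q(1) QS, of "{f}"] f sub by blast
      then show False using fT Q(3) by blast
    qed
  }
qed

section \<open>Partitions into Zariski closed sets\<close>

lemma Zariski_partition_imp_generators:
  assumes S: "mult_closed_subset R S" and cover: "S_Spec R S = C1 \<union> C2" and disj: "C1 \<inter> C2 = {}"
    and C1: "closedin (S_Zariski R S) C1" and C2: "closedin (S_Zariski R S) C2"
  obtains f1 f2 where "f1 \<in> carrier R" "f2 \<in> carrier R" "C1 = S_V R S {f1}" "C2 = S_V R S {f2}"
    "f1 \<oplus> f2 \<in> S" "f1 \<otimes> f2 \<in> S_radical R S {\<zero>}"
proof -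
  obtain I J where I: "ideal I R" "C1 = S_V R S I" and J: "ideal J R" "C2 = S_V R S J"
    using iffD1[OF closedin_S_Zariski[OF S] C1] iffD1[OF closedin_S_Zariski[OF S] C2] by blast
  have IR: "I \<subseteq> carrier R" and JR: "J \<subseteq> carrier R"
    using ideal.Icarr[OF I(1)] ideal.Icarr[OF J(1)] by auto
  \<comment> \<open>A common zero of \<open>I\<close> and \<open>J\<close> would lie in both parts.\<close>
  have "S_V R S (Idl (\<Union>{I, J})) = S_Spec R S \<inter> (C1 \<inter> C2)"
    using S_V_genideal_Union[OF S, of "{I, J}"] IR JR I J by auto
  then have "S_V R S (I <+>\<^bsub>R\<^esub> J) = {}"
    using disj union_genideal[OF I(1) J(1)] by simp
  then have "(I <+>\<^bsub>R\<^esub> J) \<inter> S \<noteq> {}"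
    by (rule ideal_meets_S[OF S add_ideals[OF I(1) J(1)]])
  then obtain f1 f2 where f: "f1 \<in> I" "f2 \<in> J" and sum: "f1 \<oplus> f2 \<in> S"
    by (auto simp: set_add_def')
  have fR: "f1 \<in> carrier R" "f2 \<in> carrier R" using f IR JR by auto
  have sub: "C1 \<subseteq> S_V R S {f1}" "C2 \<subseteq> S_V R S {f2}"
    using f unfolding I(2) J(2) S_V_def by auto
  have "S_V R S {f1} \<inter> S_V R S {f2} = {}"
  proof -
    have False if P: "P \<in> S_V R S {f1}" "P \<in> S_V R S {f2}" for P
    proof -
      have "P \<in> S_Spec R S" using P by (simp add: S_V_def)
      from S_prime_saturation[OF S this] obtain Q where Q: "primeideal Q R" "Q \<inter> S = {}"
        "\<And>E. E \<subseteq> carrier R \<Longrightarrow> P \<in> S_V R S E \<longleftrightarrow> E \<subseteq> Q" by blast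
      interpret Q: primeideal Q R by fact
      have "f1 \<in> Q" "f2 \<in> Q" using Q(3)[of "{_}"] P fR by auto
      then show False using sum Q(2) Q.a_closed by blast
    qed
    then show ?thesis by blast
  qed
  moreover have "S_V R S {f1} \<union> S_V R S {f2} \<subseteq> C1 \<union> C2"
    using S_V_subset cover by blast
  ultimately have eq: "C1 = S_V R S {f1}" "C2 = S_V R S {f2}" using sub disj by blast+
  have "S_V R S {\<zero>} \<subseteq> S_V R S {f1 \<otimes> f2}"
    using S_V_mult[OF S fR] S_V_zero[OF S] cover eq by simp
  then have "f1 \<otimes> f2 \<in> S_radical R S {\<zero>}"
    using S_radical_iff_S_V[OF S zeroideal] fR by simp
  then show thesis using that fR eq sum by blast
qed

end

section \<open>Compactness of the flat topology\<close>

text \<open>Alexander's subbase theorem for \<open>topology_generated_by\<close>; its form for an explicit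
  subbase also admits the empty intersection, which is the whole space \<open>\<Union>B\<close> and so already open.\<close>

lemma compact_space_topology_generated_by:
  assumes "\<And>C. \<lbrakk>C \<subseteq> B; \<Union>C = \<Union>B\<rbrakk> \<Longrightarrow> \<exists>C'. finite C' \<and> C' \<subseteq> C \<and> \<Union>C' = \<Union>B"
  shows "compact_space (topology_generated_by B)"
proof (rule Alexander_subbase)
  let ?X = "topology (arbitrary union_of (finite intersection_of (\<lambda>x. x \<in> B) relative_to \<Union>B))"
  have "openin ?X U \<longleftrightarrow> openin (topology_generated_by B) U" for U
  proof
    assume U: "openin ?X U"
    show "openin (topology_generated_by B) U"
    proof (rule minimal_topology_subbase[OF _ _ U])
      show "openin (topology_generated_by B) W" if "W \<in> B" for W
        using that by (rule topology_generated_by_Basis)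
      show "openin (topology_generated_by B) (\<Union>B)"
        using openin_topspace[of "topology_generated_by B"] by simp
    qed
  next
    assume "openin (topology_generated_by B) U"
    then have "generate_topology_on B U" by (rule openin_topology_generated_by)
    then show "openin ?X U"
    proof (rule generate_topology_on_coarsest[rotated 2])
      fix W assume W: "W \<in> B"
      show "openin ?X W"
        unfolding openin_subbase
        using W by (intro arbitrary_union_of_inc relative_to_subset_inc finite_intersection_of_inc) auto
    qed simp
  qed
  then show "?X = topology_generated_by B" by (simp add: topology_eq)
qed (use assms in simp)

context cring
begin

text \<open>By Alexander's theorem it is enough to treat a cover by sets \<open>V\<^sub>S(f)\<close>. The elements \<open>t\<close> for
  which \<open>V\<^sub>S(t)\<close> has a finite subcover are closed under products, because \<open>V\<^sub>S\<close> turns products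
  into unions, and they include \<open>S\<close> and every \<open>f\<close> of the cover. If zero were not among them, a
  prime ideal avoiding them all would be a point missed by the cover. So zero is one of them, and
  \<open>V\<^sub>S(0)\<close> is the whole space.\<close>

lemma compact_space_S_flat:
  assumes S: "mult_closed_subset R S"
  shows "compact_space (S_flat R S)"
  unfolding S_flat_def
proof (rule compact_space_topology_generated_by)
  let ?B = "{S_V R S {f} | f. f \<in> carrier R}"
  have UB: "\<Union>?B = S_Spec R S" using topspace_S_flat[OF S] by (simp add: S_flat_def)
  fix C assume C: "C \<subseteq> ?B" and cover: "\<Union>C = \<Union>?B"
  define T where "T = {t \<in> carrier R. \<exists>C'. finite C' \<and> C' \<subseteq> C \<and> S_V R S {t} \<subseteq> \<Union>C'}"
  have SR: "S \<subseteq> carrier R" and one: "\<one> \<in> S"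
    using S by (auto simp: mult_closed_subset_def)
  have ST: "s \<in> T" if "s \<in> S" for s
  proof -
    have "S_V R S {s} = {}" using S_V_eq_empty[OF S, of "{s}"] that SR by auto
    then show ?thesis unfolding T_def using that SR by auto
  qed
  have "\<zero> \<in> T"
  proof (rule ccontr)
    assume "\<zero> \<notin> T"
    have T: "mult_closed_subset R T"
      unfolding mult_closed_subset_def
    proof (intro conjI ballI)
      show "T \<subseteq> carrier R" by (auto simp: T_def)
      show "\<zero> \<notin> T" by fact
      show "\<one> \<in> T" by (rule ST[OF one])
      fix t u assume "t \<in> T" "u \<in> T"
      then obtain D E where tu: "t \<in> carrier R" "u \<in> carrier R"
        and "finite D" "D \<subseteq> C" "S_V R S {t} \<subseteq> \<Union>D" "finite E" "E \<subseteq> C" "S_V R S {u} \<subseteq> \<Union>E"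
        by (auto simp: T_def)
      then have "finite (D \<union> E) \<and> D \<union> E \<subseteq> C \<and> S_V R S {t \<otimes> u} \<subseteq> \<Union>(D \<union> E)"
        using S_V_mult[OF S tu] by auto
      then show "t \<otimes> u \<in> T" unfolding T_def using tu by blast
    qed
    have "{\<zero>} \<inter> T = {}" using \<open>\<zero> \<notin> T\<close> by simp
    then obtain Q where Q: "primeideal Q R" "Q \<inter> T = {}"
      using primeideal_avoiding[OF T zeroideal] by metis
    have QS: "Q \<inter> S = {}" using ST Q(2) by blast
    have "Q \<in> \<Union>C" using primeideal_in_S_Spec[OF S Q(1) QS] cover UB by simp
    then obtain W where W: "W \<in> C" "Q \<in> W" by (rule UnionE)
    from W(1) have "W \<in> ?B" by (rule subsetD[OF C])
    then obtain f where "f \<in> carrier R" "W = S_V R S {f}" by blast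
    with W have f: "f \<in> carrier R" "S_V R S {f} \<in> C" "Q \<in> S_V R S {f}" by simp_all
    have "f \<in> Q" using primeideal_in_S_V_iff[OF S Q(1) QS, of "{f}"] f by simp
    moreover have "f \<in> T"
      unfolding T_def using f by (auto intro!: exI[of _ "{S_V R S {f}}"])
    ultimately show False using Q(2) by blast
  qed
  then obtain C' where C': "finite C'" "C' \<subseteq> C" "S_Spec R S \<subseteq> \<Union>C'"
    using S_V_zero[OF S] by (auto simp: T_def)
  have "\<Union>C' = S_Spec R S"
    using C'(3) Union_mono[OF C'(2)] unfolding cover UB by (rule subset_antisym[rotated])
  with C'(1,2) show "\<exists>C'. finite C' \<and> C' \<subseteq> C \<and> \<Union>C' = \<Union>?B"
    unfolding UB by blast
qed

lemma closedin_S_Zariski_S_V_singleton: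
  assumes S: "mult_closed_subset R S" and f: "f \<in> carrier R"
  shows "closedin (S_Zariski R S) (S_V R S {f})"
proof -
  have "S_V R S (Idl (\<Union>{{f}})) = S_V R S {f}"
    using S_V_genideal_Union[OF S, of "{{f}}"] f S_V_subset[of R S "{f}"] by auto
  then show ?thesis
    using closedin_S_Zariski[OF S] genideal_ideal[of "{f}"] f by auto
qed

text \<open>The sets \<open>V\<^sub>S(f)\<close> are both flat open and Zariski closed, and finite intersections keep both
  properties; so the sets with both properties form a base of the flat topology.\<close>

lemma S_flat_open_Zariski_closed_nbhd:
  assumes S: "mult_closed_subset R S" and U: "openin (S_flat R S) U" and P: "P \<in> U"
  shows "\<exists>W. openin (S_flat R S) W \<and> closedin (S_Zariski R S) W \<and> P \<in> W \<and> W \<subseteq> U"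
proof -
  let ?B = "{S_V R S {f} | f. f \<in> carrier R}"
  have "generate_topology_on ?B U"
    using U unfolding S_flat_def by (rule openin_topology_generated_by)
  then show ?thesis using P
  proof (induction U arbitrary: P)
    case (Int a b)
    from Int.prems have P: "P \<in> a" "P \<in> b" by auto
    from Int.IH(1)[OF P(1)] Int.IH(2)[OF P(2)] obtain W V
      where "openin (S_flat R S) W" "closedin (S_Zariski R S) W" "P \<in> W" "W \<subseteq> a"
        and "openin (S_flat R S) V" "closedin (S_Zariski R S) V" "P \<in> V" "V \<subseteq> b"
      by (elim exE conjE)
    then have "openin (S_flat R S) (W \<inter> V) \<and> closedin (S_Zariski R S) (W \<inter> V) \<and>
        P \<in> W \<inter> V \<and> W \<inter> V \<subseteq> a \<inter> b"
      by (intro conjI openin_Int closedin_Int) auto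
    then show ?case by (rule exI)
  next
    case (UN K)
    from UN.prems obtain k where k: "k \<in> K" "P \<in> k" by (rule UnionE)
    from UN.IH[OF k] obtain W
      where "openin (S_flat R S) W" "closedin (S_Zariski R S) W" "P \<in> W" "W \<subseteq> k"
      by (elim exE conjE)
    with k(1) have "openin (S_flat R S) W \<and> closedin (S_Zariski R S) W \<and> P \<in> W \<and> W \<subseteq> \<Union>K"
      by auto
    then show ?case by (rule exI)
  next
    case (Basis s)
    then obtain f where f: "f \<in> carrier R" "s = S_V R S {f}" by blast
    have "openin (S_flat R S) s"
      unfolding S_flat_def by (rule topology_generated_by_Basis[OF Basis.hyps])
    then show ?case
      using closedin_S_Zariski_S_V_singleton[OF S f(1)] Basis.prems f(2) by blast
  qed simp
qed

lemma S_flat_clopen_imp_closedin_Zariski: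
  assumes S: "mult_closed_subset R S"
    and open_C: "openin (S_flat R S) C" and closed_C: "closedin (S_flat R S) C"
  shows "closedin (S_Zariski R S) C"
proof -
  let ?W = "{W. openin (S_flat R S) W \<and> closedin (S_Zariski R S) W \<and> W \<subseteq> C}"
  have "compactin (S_flat R S) C"
    by (rule closedin_compact_space[OF compact_space_S_flat[OF S] closed_C])
  moreover have "C \<subseteq> \<Union>?W"
    using S_flat_open_Zariski_closed_nbhd[OF S open_C] by blast
  ultimately obtain F where F: "finite F" "F \<subseteq> ?W" "C \<subseteq> \<Union>F"
    using compactinD[of "S_flat R S" C ?W] by auto
  have "\<Union>F = C" using F by blast
  moreover have "closedin (S_Zariski R S) (\<Union>F)" using F by (intro closedin_Union) auto
  ultimately show ?thesis by simp
qed

end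

theorem theorem5p1:
  fixes R (structure) and S :: "'a set" and C1 C2 :: "'a set set"
  assumes "cring R" and "\<one> \<noteq> \<zero>"
    and "mult_closed_subset R S"
    and "S_Spec R S = C1 \<union> C2" and "C1 \<inter> C2 = {}"
  shows "((closedin (S_Zariski R S) C1 \<and> closedin (S_Zariski R S) C2) \<longleftrightarrow>
          (\<exists>f1\<in>carrier R. \<exists>f2\<in>carrier R. C1 = S_V R S {f1} \<and> C2 = S_V R S {f2} \<and>
              f1 \<oplus> f2 \<in> S \<and> f1 \<otimes> f2 \<in> S_radical R S {\<zero>})) \<and>
         ((\<exists>f1\<in>carrier R. \<exists>f2\<in>carrier R. C1 = S_V R S {f1} \<and> C2 = S_V R S {f2} \<and>
              f1 \<oplus> f2 \<in> S \<and> f1 \<otimes> f2 \<in> S_radical R S {\<zero>}) \<longleftrightarrow>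
          (closedin (S_flat R S) C1 \<and> closedin (S_flat R S) C2))"
proof -
  interpret cring R by fact
  note S = \<open>mult_closed_subset R S\<close> and cover = \<open>S_Spec R S = C1 \<union> C2\<close>
    and disj = \<open>C1 \<inter> C2 = {}\<close>
  let ?Z = "closedin (S_Zariski R S) C1 \<and> closedin (S_Zariski R S) C2"
  let ?G = "\<exists>f1\<in>carrier R. \<exists>f2\<in>carrier R. C1 = S_V R S {f1} \<and> C2 = S_V R S {f2} \<and>
              f1 \<oplus> f2 \<in> S \<and> f1 \<otimes> f2 \<in> S_radical R S {\<zero>}"
  let ?F = "closedin (S_flat R S) C1 \<and> closedin (S_flat R S) C2"
  have compl: "S_Spec R S - C1 = C2" "S_Spec R S - C2 = C1" using cover disj by auto
  have top: "topspace (S_flat R S) = S_Spec R S" by (rule topspace_S_flat[OF S])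
  have "?G" if Z: "?Z"
    by (rule Zariski_partition_imp_generators[OF S cover disj])
      (use Z in \<open>blast+\<close>)
  moreover have "?F" if "?G"
  proof -
    have "openin (S_flat R S) C1" "openin (S_flat R S) C2"
      using that unfolding S_flat_def by (auto intro!: topology_generated_by_Basis)
    then show ?thesis using cover compl unfolding closedin_def top by auto
  qed
  moreover have "?Z" if "?F"
  proof -
    have "openin (S_flat R S) C1" "openin (S_flat R S) C2"
      using that compl unfolding closedin_def top by auto
    with that show ?thesis using S_flat_clopen_imp_closedin_Zariski[OF S] by blast
  qed
  ultimately show ?thesis by blast
qed

end
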